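(* For $n\ge 2$ let $P_{2n}(x) = x^{2n} - x^{n+1} - x^n - x^{n-1} + 1$, and let $h_n$ be the maximum modulus of the complex roots of $P_{2n}(x)$. Then $\lim_{n\to\infty} h_n^{2n} = \alpha^2 = 6.854\ldots$, where $\alpha = \frac{3+\sqrt5}{2} = 2.618\ldots$ is the greatest root of $x^2-3x+1$. *)

theory Defs
  imports
    Complex_Main
    "HOL-Computational_Algebra.Polynomial"
    "HOL-Computational_Algebra.Fundamental_Theorem_Algebra"
begin

text \<open>
  The indices of interest are \<open>n \<ge> 2\<close>; the values at \<open>n = 0\<close> (where \<open>n - 1\<close> is truncated)
  and \<open>n = 1\<close> do not affect limits as \<open>n\<close> tends to infinity.
\<close>

definition P2n :: "nat \<Rightarrow> complex poly" where
  "P2n n = monom 1 (2 * n) - monom 1 (n + 1) - monom 1 n - monom 1 (n - 1) + 1"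

definition h :: "nat \<Rightarrow> real" where
  "h n = Max (cmod ` {z. poly (P2n n) z = 0})"

text \<open>For \<open>n \<ge> 2\<close> the maximum is taken over a finite nonempty set, so it is a genuine maximum.\<close>

lemma finite_roots_P2n: "finite {z. poly (P2n n) z = 0}"
proof (rule poly_roots_finite)
  have "poly (P2n n) 1 = -1" by (simp add: P2n_def poly_monom)
  thus "P2n n \<noteq> 0" by auto
qed

lemma roots_P2n_nonempty:
  assumes "n \<ge> 2"
  shows "{z. poly (P2n n) z = 0} \<noteq> {}"
proof -
  have "poly (P2n n) 1 = -1" "poly (P2n n) 0 = 1"
    using assms by (simp_all add: P2n_def poly_monom power_0_left)
  hence "\<not> constant (poly (P2n n))"
    unfolding constant_def by (metis one_neq_neg_one)
  thus ?thesis using fundamental_theorem_of_algebra by blast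
qed

definition \<alpha> :: real where
  "\<alpha> = (3 + sqrt 5) / 2"

end

theory Submission
  imports Defs
begin

text \<open>
  Dividing \<open>P\<^sub>2\<^sub>n(z) = 0\<close> by \<open>z^n\<close> gives \<open>z^n + 1/z^n = 1 + (z + 1/z)\<close>. The map \<open>z \<mapsto> z + 1/z\<close> sends
  the circle of radius \<open>r\<close> to the ellipse with semi-axes \<open>r + 1/r\<close> and \<open>\<bar>r - 1/r\<bar>\<close>. For a root of
  maximal modulus \<open>r\<close>, put \<open>R = r^n\<close>. A real root \<open>x > 1\<close> satisfies \<open>x^n + 1/x^n \<ge> 3\<close>, hence
  \<open>R \<ge> \<alpha>\<close>. Conversely \<open>R\<close> is bounded, so \<open>r \<rightarrow> 1\<close>; the ellipse of \<open>z\<close> collapses to \<open>[-2, 2]\<close>, and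
  comparing it with the ellipse of \<open>z^n\<close> squeezes \<open>R + 1/R\<close> to \<open>3 = \<alpha> + 1/\<alpha>\<close>.
\<close>

lemma alpha_gt_1: "\<alpha> > 1"
  by (simp add: \<alpha>_def add_pos_pos)

lemma alpha_square: "\<alpha>\<^sup>2 = 3 * \<alpha> - 1"
  unfolding \<alpha>_def by (simp add: power2_eq_square field_simps)

lemma alpha_plus_inverse: "\<alpha> + 1 / \<alpha> = 3"
  using alpha_square alpha_gt_1 by (simp add: field_simps power2_eq_square)

lemma alpha_bounds: "2.618 \<le> \<alpha>" "\<alpha> < 2.619"
proof -
  have "2.236 \<le> sqrt 5" by (rule real_le_rsqrt) (simp add: power2_eq_square)
  thus "2.618 \<le> \<alpha>" by (simp add: \<alpha>_def)
  have "sqrt 5 < 2.238" by (rule real_less_lsqrt) (simp_all add: power2_eq_square)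
  thus "\<alpha> < 2.619" by (simp add: \<alpha>_def)
qed

lemma alpha_greatest_root:
  fixes x :: real
  assumes "x\<^sup>2 - 3 * x + 1 = 0"
  shows "x \<le> \<alpha>"
proof (rule ccontr)
  assume "\<not> x \<le> \<alpha>"
  \<comment> \<open>The second root is \<open>3 - \<alpha>\<close>, so this product is the quadratic
    itself.\<close>
  hence "(x - \<alpha>) * (x + \<alpha> - 3) > 0"
    using alpha_bounds by (intro mult_pos_pos) auto
  thus False
    using assms alpha_square by (simp add: algebra_simps power2_eq_square)
qed

text \<open>The factored form shows the sign once \<open>x * y \<ge> 1\<close>, which yields both
  monotonicity lemmas.\<close>

lemma plus_inverse_diff:
  fixes x y :: real
  assumes "x > 0" "y > 0"
  shows "(y + 1 / y) - (x + 1 / x) = (y - x) * (1 - 1 / (x * y))"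
  using assms by (simp add: field_simps)

lemma plus_inverse_mono:
  fixes x y :: real
  assumes "1 \<le> x" "x \<le> y"
  shows "x + 1 / x \<le> y + 1 / y"
proof -
  have "1 \<le> x * y" using assms mult_mono[of 1 x 1 y] by simp
  hence "0 \<le> (y - x) * (1 - 1 / (x * y))"
    using assms by (intro mult_nonneg_nonneg) (auto simp: field_simps)
  thus ?thesis using plus_inverse_diff[of x y] assms by simp
qed

lemma plus_inverse_less:
  fixes x y :: real
  assumes "1 \<le> x" "x < y"
  shows "x + 1 / x < y + 1 / y"
proof -
  have "1 < x * y" using assms mult_le_less_imp_less[of 1 x 1 y] by simp
  hence "0 < (y - x) * (1 - 1 / (x * y))"
    using assms by (intro mult_pos_pos) (auto simp: field_simps)
  thus ?thesis using plus_inverse_diff[of x y] assms by simp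
qed

lemma plus_inverse_ge_2:
  fixes x :: real
  assumes "1 \<le> x"
  shows "2 \<le> x + 1 / x"
  using plus_inverse_mono[of 1 x] assms by simp

lemma poly_P2n_eq_0_iff:
  assumes "n \<ge> 1" "z \<noteq> 0"
  shows "poly (P2n n) z = 0 \<longleftrightarrow> z ^ n + 1 / z ^ n = 1 + (z + 1 / z)"
proof -
  obtain m where n: "n = Suc m" using assms by (cases n) auto
  have "poly (P2n n) z = z ^ n * ((z ^ n + 1 / z ^ n) - (1 + (z + 1 / z)))"
    using assms(2) unfolding n
    by (simp add: P2n_def poly_monom field_simps power_add mult_2 power_mult mult_2_right)
  thus ?thesis using assms(2) by auto
qed

text \<open>For \<open>n \<ge> 2\<close> the exponent \<open>n - 1\<close> is positive, so the value
  at 0 is 1; for \<open>n = 1\<close> the polynomial is -x.\<close>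

lemma P2n_root_nonzero:
  assumes "n \<ge> 2" "poly (P2n n) z = 0"
  shows "z \<noteq> 0"
  using assms by (auto simp: P2n_def poly_monom power_0_left)

lemma cmod_root_le_h: "poly (P2n n) z = 0 \<Longrightarrow> cmod z \<le> h n"
  unfolding h_def using finite_roots_P2n by (intro Max_ge) auto

lemma h_attained:
  assumes "n \<ge> 2"
  obtains z where "poly (P2n n) z = 0" "cmod z = h n"
proof -
  have "h n \<in> cmod ` {z. poly (P2n n) z = 0}"
    unfolding h_def using finite_roots_P2n roots_P2n_nonempty[OF assms] by (intro Max_in) auto
  thus ?thesis using that by auto
qed

lemma real_P2n_root:
  assumes "n \<ge> 2"
  obtains x :: real where "x > 1" "x ^ n + 1 / x ^ n = 1 + (x + 1 / x)"
proof -
  define f :: "real \<Rightarrow> real" where "f x = x ^ n + 1 / x ^ n - (1 + (x + 1 / x))" for x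
  have "(3::real) ^ n \<ge> 9" using power_increasing[OF assms, of "3::real"] by simp
  moreover have "1 / (3::real) ^ n \<ge> 0" by simp
  ultimately have "f 3 \<ge> 0" unfolding f_def by linarith
  moreover have "f 1 = -1" by (simp add: f_def)
  moreover have "continuous_on {1..3} f"
    unfolding f_def by (intro continuous_intros) auto
  ultimately obtain x where "1 \<le> x" "x \<le> 3" "f x = 0"
    using IVT'[of f 1 0 3] by auto
  moreover from this have "x \<noteq> 1" using \<open>f 1 = -1\<close> by auto
  ultimately show ?thesis using that[of x] by (auto simp: f_def)
qed

lemma h_power_ge_alpha:
  assumes "n \<ge> 2"
  shows "h n > 1" "h n ^ n \<ge> \<alpha>"
proof -
  obtain x :: real where x: "x > 1" "x ^ n + 1 / x ^ n = 1 + (x + 1 / x)"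
    using real_P2n_root[OF assms] .
  have "complex_of_real (x ^ n + 1 / x ^ n) = of_real (1 + (x + 1 / x))"
    using x(2) by simp
  hence "poly (P2n n) (of_real x) = 0"
    using assms x(1) by (subst poly_P2n_eq_0_iff) auto
  from cmod_root_le_h[OF this] have xh: "x \<le> h n" using x(1) by simp
  with x(1) show "h n > 1" by simp
  \<comment> \<open>Otherwise the left side of the root equation would be below 3, while the right
    side is at least 1 + 2.\<close>
  have "x ^ n \<ge> \<alpha>"
  proof (rule ccontr)
    assume "\<not> x ^ n \<ge> \<alpha>"
    hence "x ^ n + 1 / x ^ n < \<alpha> + 1 / \<alpha>"
      using x(1) by (intro plus_inverse_less) auto
    thus False
      using x plus_inverse_ge_2[of x] alpha_plus_inverse by simp
  qed
  also have "x ^ n \<le> h n ^ n" using x(1) xh by (intro power_mono) auto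
  finally show "h n ^ n \<ge> \<alpha>" .
qed

text \<open>In polar form \<open>c\<close> and \<open>s\<close> are the cosine and sine of the
  argument of \<open>z\<close>; inversion negates the argument.\<close>

lemma plus_inverse_complex_ellipse:
  assumes "z \<noteq> 0" and "r = cmod z"
  obtains c s where "c\<^sup>2 + s\<^sup>2 = 1"
    "z + 1 / z = Complex ((r + 1 / r) * c) ((r - 1 / r) * s)"
proof
  have r: "r > 0" "r\<^sup>2 = (Re z)\<^sup>2 + (Im z)\<^sup>2"
    using assms by (simp_all add: cmod_power2)
  show "(Re z / r)\<^sup>2 + (Im z / r)\<^sup>2 = 1"
    using r by (simp add: power_divide flip: add_divide_distrib r(2))
  show "z + 1 / z = Complex ((r + 1 / r) * (Re z / r)) ((r - 1 / r) * (Im z / r))"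
    using r(1) by (simp add: complex_eq_iff Re_divide Im_divide flip: r(2))
      (simp add: field_simps power2_eq_square)
qed

text \<open>Any bound independent of \<open>n\<close> would do: its n-th root tends to 1 and forces
  \<open>h n\<close> to 1.\<close>

lemma h_power_bounded:
  assumes "n \<ge> 2"
  shows "h n ^ n \<le> 6"
proof -
  obtain z where z: "poly (P2n n) z = 0" "cmod z = h n"
    using h_attained[OF assms] .
  define r R where "r = h n" and "R = h n ^ n"
  have r: "r > 1" and R: "R > 1"
    using h_power_ge_alpha[OF assms] alpha_gt_1 by (auto simp: r_def R_def)
  have nz: "z \<noteq> 0" using P2n_root_nonzero[OF assms z(1)] .
  have eq: "z ^ n = 1 + (z + 1 / z) - 1 / z ^ n"
    using poly_P2n_eq_0_iff[OF _ nz, of n] assms z(1) by (simp add: algebra_simps)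
  have "R = cmod (1 + (z + 1 / z) - 1 / z ^ n)"
    unfolding R_def z(2)[symmetric] norm_power[symmetric] using eq by simp
  also have "\<dots> \<le> cmod (1 + (z + 1 / z)) + cmod (1 / z ^ n)" by (rule norm_triangle_ineq4)
  also have "cmod (1 / z ^ n) = 1 / R" by (simp add: norm_divide norm_power z(2) R_def)
  also have "cmod (1 + (z + 1 / z)) \<le> cmod 1 + (cmod z + cmod (1 / z))"
    by (intro norm_triangle_mono norm_triangle_ineq order_refl)
  also have "\<dots> = 1 + (r + 1 / r)" by (simp add: norm_divide z(2) r_def)
  finally have "R \<le> 1 + (r + 1 / r) + 1 / R" by simp
  moreover have "1 / r \<le> 1" "1 / R \<le> 1" using r R by auto
  ultimately have le: "R \<le> r + 3" by linarith
  \<comment> \<open>Together with \<open>R \<le> r + 3\<close> this bounds \<open>r\<close> by 3,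
    hence \<open>R\<close> by 6.\<close>
  have "r ^ 2 \<le> R"
    using r assms unfolding R_def r_def by (intro power_increasing) auto
  with le have "r * r \<le> r + 3" by (simp add: power2_eq_square)
  moreover have "r * r > 3 * r" if "r > 3" using that by simp
  ultimately have "r \<le> 3" by linarith
  with le show ?thesis by (simp add: R_def)
qed

text \<open>
  The point of the \<open>z^n\<close>-ellipse is \<open>(A C, B S)\<close>, so \<open>1 + a c = A C\<close> and \<open>b s = B S\<close>, where
  \<open>A\<^sup>2 = B\<^sup>2 + 4\<close>, \<open>b\<^sup>2 = a\<^sup>2 - 4\<close>, and \<open>B\<^sup>2 \<ge> 5\<close> because \<open>R \<ge> \<alpha>\<close>.
\<close>
lemma h_plus_inverse_bounds:
  assumes "n \<ge> 2"
  defines "a \<equiv> h n + 1 / h n" and "A \<equiv> h n ^ n + 1 / h n ^ n"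
  shows "3 \<le> A" "A\<^sup>2 \<le> (1 + a)\<^sup>2 + 9 / 5 * (a\<^sup>2 - 4)"
proof -
  obtain z where z: "poly (P2n n) z = 0" "cmod z = h n"
    using h_attained[OF assms(1)] .
  define r R where "r = h n" and "R = h n ^ n"
  have r: "r > 1" and R: "R \<ge> \<alpha>" "R > 1"
    using h_power_ge_alpha[OF assms(1)] alpha_gt_1 by (auto simp: r_def R_def)
  define b B where "b = r - 1 / r" and "B = R - 1 / R"
  have a: "a = r + 1 / r" and A: "A = R + 1 / R" by (simp_all add: a_def A_def r_def R_def)
  have b2: "b\<^sup>2 = a\<^sup>2 - 4" and B2: "B\<^sup>2 = A\<^sup>2 - 4"
    using r R(2) by (simp_all add: a A b_def B_def field_simps power2_eq_square)
  show A3: "3 \<le> A"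
    using plus_inverse_mono[of \<alpha> R] alpha_gt_1 R alpha_plus_inverse by (simp add: A)
  hence B5: "B\<^sup>2 \<ge> 5" using power_mono[of 3 A 2] B2 by simp
  have nz: "z \<noteq> 0" using P2n_root_nonzero[OF assms(1) z(1)] .
  obtain c s where cs: "c\<^sup>2 + s\<^sup>2 = 1" "z + 1 / z = Complex (a * c) (b * s)"
    using plus_inverse_complex_ellipse[OF nz, of r] z(2) by (auto simp: r_def a b_def)
  obtain C S where CS: "C\<^sup>2 + S\<^sup>2 = 1" "z ^ n + 1 / z ^ n = Complex (A * C) (B * S)"
    using plus_inverse_complex_ellipse[of "z ^ n" R] nz z(2)
    by (auto simp: R_def A B_def norm_power)
  have "Complex (A * C) (B * S) = 1 + Complex (a * c) (b * s)"
    using poly_P2n_eq_0_iff[OF _ nz, of n] assms(1) z(1) cs(2) CS(2) by simp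
  hence AC: "A * C = 1 + a * c" and BS: "B * S = b * s"
    by (simp_all add: complex_eq_iff)
  have "c\<^sup>2 \<le> 1" "s\<^sup>2 \<le> 1" using cs(1) by (smt (verit) zero_le_power2)+
  have a0: "a \<ge> 0" using r by (simp add: a)
  have "\<bar>c\<bar> \<le> 1" using \<open>c\<^sup>2 \<le> 1\<close> by (simp add: abs_square_le_1)
  hence "\<bar>a * c\<bar> \<le> a" using a0 mult_left_mono[of "\<bar>c\<bar>" 1 a] by (simp add: abs_mult)
  hence "\<bar>1 + a * c\<bar> \<le> \<bar>1 + a\<bar>" using a0 by linarith
  hence AC2: "(A * C)\<^sup>2 \<le> (1 + a)\<^sup>2" unfolding AC by (simp only: abs_le_square_iff)
  have "B\<^sup>2 * S\<^sup>2 = b\<^sup>2 * s\<^sup>2" using arg_cong[OF BS, of "\<lambda>x. x\<^sup>2"] by (simp add: power_mult_distrib)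
  also have "\<dots> \<le> b\<^sup>2" using mult_left_mono[OF \<open>s\<^sup>2 \<le> 1\<close>, of "b\<^sup>2"] by simp
  finally have BS2: "B\<^sup>2 * S\<^sup>2 \<le> b\<^sup>2" .
  \<comment> \<open>Since \<open>B\<close> stays away from 0, a flat ellipse for \<open>z\<close>
    (small \<open>b\<close>) makes \<open>S\<close> small.\<close>
  have "5 * S\<^sup>2 \<le> B\<^sup>2 * S\<^sup>2" using B5 by (intro mult_right_mono) auto
  with BS2 have S2: "S\<^sup>2 \<le> b\<^sup>2 / 5" by simp
  \<comment> \<open>The last two terms of the expansion are at most \<open>b\<^sup>2\<close> and
    \<open>4 / 5 * b\<^sup>2\<close>, whence 9/5.\<close>
  have "A\<^sup>2 = A\<^sup>2 * (C\<^sup>2 + S\<^sup>2)" using CS(1) by simp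
  also have "\<dots> = (A * C)\<^sup>2 + B\<^sup>2 * S\<^sup>2 + 4 * S\<^sup>2"
    unfolding B2 by (simp add: algebra_simps power_mult_distrib)
  finally have "A\<^sup>2 \<le> (1 + a)\<^sup>2 + 9 / 5 * b\<^sup>2" using AC2 BS2 S2 by simp
  thus "A\<^sup>2 \<le> (1 + a)\<^sup>2 + 9 / 5 * (a\<^sup>2 - 4)" by (simp add: b2)
qed

lemma h_tendsto_1: "h \<longlonglongrightarrow> 1"
proof (rule tendsto_sandwich)
  show "\<forall>\<^sub>F n in sequentially. 1 \<le> h n"
    using eventually_ge_at_top[of 2] by eventually_elim (use h_power_ge_alpha in force)
  show "\<forall>\<^sub>F n in sequentially. h n \<le> root n 6"
    using eventually_ge_at_top[of 2]
  proof eventually_elim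
    case (elim n)
    hence "h n = root n (h n ^ n)" using h_power_ge_alpha(1)[of n] by (simp add: real_root_power_cancel)
    also have "\<dots> \<le> root n 6" using elim h_power_bounded[of n] by simp
    finally show ?case .
  qed
  show "(\<lambda>n. root n 6) \<longlonglongrightarrow> 1" by (rule LIMSEQ_root_const) simp
qed simp

lemma h_power_plus_inverse_tendsto: "(\<lambda>n. h n ^ n + 1 / h n ^ n) \<longlonglongrightarrow> 3"
proof (rule tendsto_sandwich)
  let ?g = "\<lambda>n. sqrt ((1 + (h n + 1 / h n))\<^sup>2 + 9 / 5 * ((h n + 1 / h n)\<^sup>2 - 4))"
  show "\<forall>\<^sub>F n in sequentially. 3 \<le> h n ^ n + 1 / h n ^ n"
    using eventually_ge_at_top[of 2] by eventually_elim (rule h_plus_inverse_bounds)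
  show "\<forall>\<^sub>F n in sequentially. h n ^ n + 1 / h n ^ n \<le> ?g n"
    using eventually_ge_at_top[of 2]
    by eventually_elim (intro real_le_rsqrt h_plus_inverse_bounds)
  \<comment> \<open>At \<open>h n = 1\<close> the 9/5 term vanishes and the root is sqrt 9 =
    3.\<close>
  have "?g \<longlonglongrightarrow> sqrt ((1 + (1 + 1 / 1))\<^sup>2 + 9 / 5 * ((1 + 1 / 1)\<^sup>2 - 4))"
    by (intro tendsto_intros h_tendsto_1) auto
  thus "?g \<longlonglongrightarrow> 3" by simp
qed simp

text \<open>Solving R + 1/R = A for the root R > 1 expresses \<open>h n ^ n\<close> continuously in
  a quantity whose limit is known.\<close>

lemma h_power_tendsto_alpha: "(\<lambda>n. h n ^ n) \<longlonglongrightarrow> \<alpha>"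
proof -
  let ?A = "\<lambda>n. h n ^ n + 1 / h n ^ n"
  have "(\<lambda>n. (?A n + sqrt ((?A n)\<^sup>2 - 4)) / 2) \<longlonglongrightarrow> (3 + sqrt (3\<^sup>2 - 4)) / 2"
    by (intro tendsto_intros h_power_plus_inverse_tendsto) auto
  also have "(3 + sqrt (3\<^sup>2 - 4)) / 2 = \<alpha>" by (simp add: \<alpha>_def)
  finally show ?thesis
  proof (rule Lim_transform_eventually)
    show "\<forall>\<^sub>F n in sequentially. (?A n + sqrt ((?A n)\<^sup>2 - 4)) / 2 = h n ^ n"
      using eventually_ge_at_top[of 2]
    proof eventually_elim
      case (elim n)
      define R where "R = h n ^ n"
      have R: "R > 1" using h_power_ge_alpha(2)[OF elim] alpha_gt_1 by (simp add: R_def)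
      have "(R + 1 / R)\<^sup>2 - 4 = (R - 1 / R)\<^sup>2" using R by (simp add: field_simps power2_eq_square)
      \<comment> \<open>This makes \<open>R - 1 / R\<close> nonnegative, so it is the square root of
        its square.\<close>
      moreover have "1 / R \<le> R" using R by (smt (verit) divide_le_eq_1)
      ultimately show ?case unfolding R_def[symmetric] by simp
    qed
  qed
qed

theorem theorem2:
  shows "(\<lambda>n. h n ^ (2 * n)) \<longlonglongrightarrow> \<alpha>\<^sup>2
    \<and> \<alpha>\<^sup>2 - 3 * \<alpha> + 1 = 0 \<and> (\<forall>x::real. x\<^sup>2 - 3 * x + 1 = 0 \<longrightarrow> x \<le> \<alpha>)
    \<and> 2.618 \<le> \<alpha> \<and> \<alpha> < 2.619 \<and> 6.854 \<le> \<alpha>\<^sup>2 \<and> \<alpha>\<^sup>2 < 6.855"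
proof (intro conjI allI impI)
  have "(\<lambda>n. (h n ^ n)\<^sup>2) \<longlonglongrightarrow> \<alpha>\<^sup>2" by (intro tendsto_power h_power_tendsto_alpha)
  thus "(\<lambda>n. h n ^ (2 * n)) \<longlonglongrightarrow> \<alpha>\<^sup>2" by (simp add: mult.commute flip: power_mult)
  show "\<alpha>\<^sup>2 - 3 * \<alpha> + 1 = 0" by (simp add: alpha_square)
  show "6.854 \<le> \<alpha>\<^sup>2" using alpha_bounds by (simp add: alpha_square)
  \<comment> \<open>The bound \<open>\<alpha> < 2.619\<close> only gives
    \<open>\<alpha>\<^sup>2 < 6.857\<close>, so a sharper estimate is needed.\<close>
  have "sqrt 5 < 2.2362" by (rule real_less_lsqrt) (simp_all add: power2_eq_square)
  thus "\<alpha>\<^sup>2 < 6.855" unfolding alpha_square by (simp add: \<alpha>_def)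
qed (use alpha_greatest_root alpha_bounds in auto)

end
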